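(* Let $X$ be a complex Banach space with open unit ball $B_X$, and let $\varphi: B_X\to B_X$ be holomorphic. Let $C_\varphi: H(B_X)\to H(B_X)$, $C_\varphi(f)=f\circ\varphi$. The following assertions are equivalent: (1) $\varphi$ has stable orbits on $B_X$; (2) $C_\varphi: H(B_X)\to H(B_X)$ is power bounded; (3) the sequence $\big(\tfrac1n C_\varphi^n\big)_{n}$ is equicontinuous in $L(H(B_X))$; (4) $C_\varphi: H(B_X)\to H(B_X)$ is topologizable.
   Context: A function is holomorphic if it is (complex) Fréchet differentiable at every point. $H(B_X)$ is the space of all holomorphic functions $f:B_X\to\mathbb{C}$ with the topology $\tau_0$ of uniform convergence on compact subsets of $B_X$; it is a locally convex Hausdorff space. For a locally convex Hausdorff space $E$, $\Gamma_E$ is the set of continuous seminorms on $E$, $L(E)$ is the space of continuous linear maps $E\to E$, and $T^n$ is the $n$-th iterate of $T$ ($T^0=\mathrm{id}$). $T\in L(E)$ is power bounded if $\{T^n: n\ge 0\}$ is equicontinuous. $T$ is topologizable if for each $q\in\Gamma_E$ there exist a sequence $(a_n)_{n\in\mathbb{N}}$ of positive numbers and $p\in\Gamma_E$ such that $q(a_nT^nx)\le p(x)$ for all $x\in E$ and all $n\in\mathbb{N}$. A self map $f:U\to U$ of an open set $U\subseteq X$ has stable orbits if for every compact $K\subseteq U$ there is a compact $L\subseteq U$ such that $f^n(K)\subseteq L$ for every $n\in\mathbb{N}$, where $f^n$ is the $n$-th iterate of $f$. *)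

theory Defs
  imports "HOL-Analysis.Analysis" "HOL-Library.Function_Algebras"
begin

section \<open>Complex vector spaces and complex Banach spaces\<close>

class complex_vector = ab_group_add +
  fixes scaleC :: "complex \<Rightarrow> 'a \<Rightarrow> 'a"  (infixr "*\<^sub>C" 75)
  assumes scaleC_add_right: "c *\<^sub>C (x + y) = c *\<^sub>C x + c *\<^sub>C y"
    and scaleC_add_left: "(c + d) *\<^sub>C x = c *\<^sub>C x + d *\<^sub>C x"
    and scaleC_scaleC: "c *\<^sub>C (d *\<^sub>C x) = (c * d) *\<^sub>C x"
    and scaleC_one: "1 *\<^sub>C x = x"

text \<open>The real structure required by the library class is the one obtained by restricting scalars.\<close>

class complex_banach = complex_vector + banach +
  assumes scaleR_scaleC: "r *\<^sub>R x = complex_of_real r *\<^sub>C x"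
    and norm_scaleC: "norm (c *\<^sub>C x) = cmod c * norm x"

instantiation complex :: complex_banach
begin

definition scaleC_complex_def: "c *\<^sub>C (z::complex) = c * z"

instance
  by standard (simp_all add: scaleC_complex_def algebra_simps norm_mult scaleR_conv_of_real)

end

instantiation "fun" :: (type, complex_vector) complex_vector
begin

definition scaleC_fun_def: "c *\<^sub>C (f::'a \<Rightarrow> 'b) = (\<lambda>x. c *\<^sub>C f x)"

instance
  by standard
    (simp_all add: scaleC_fun_def plus_fun_def fun_eq_iff scaleC_add_right scaleC_add_left
      scaleC_scaleC scaleC_one)

end


section \<open>Operators on a locally convex space\<close>

text \<open>A topological vector space is given by a topology \<open>E\<close> whose underlying set
  \<open>topspace E\<close> is a linear subspace of a type of class \<open>complex_vector\<close>; maps and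
  seminorms on \<open>E\<close> are only relevant on \<open>topspace E\<close>.\<close>

definition continuous_seminorms :: "'e::complex_vector topology \<Rightarrow> ('e \<Rightarrow> real) set" where
  "continuous_seminorms E =
    {q. continuous_map E euclideanreal q \<and>
        (\<forall>x\<in>topspace E. 0 \<le> q x) \<and>
        (\<forall>x\<in>topspace E. \<forall>y\<in>topspace E. q (x + y) \<le> q x + q y) \<and>
        (\<forall>c. \<forall>x\<in>topspace E. q (c *\<^sub>C x) = cmod c * q x)}"

definition continuous_linear_maps :: "'e::complex_vector topology \<Rightarrow> ('e \<Rightarrow> 'e) set" where
  "continuous_linear_maps E =
    {T. continuous_map E E T \<and>
        (\<forall>x\<in>topspace E. \<forall>y\<in>topspace E. T (x + y) = T x + T y) \<and>
        (\<forall>c. \<forall>x\<in>topspace E. T (c *\<^sub>C x) = c *\<^sub>C T x)}"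

text \<open>Equicontinuity of a family in \<open>L(E)\<close>, at every point and with respect to the translation-invariant uniformity of
  \<open>E\<close>.\<close>

definition equicontinuous :: "'e::complex_vector topology \<Rightarrow> ('e \<Rightarrow> 'e) set \<Rightarrow> bool" where
  "equicontinuous E \<T> \<longleftrightarrow>
    \<T> \<subseteq> continuous_linear_maps E \<and>
    (\<forall>x\<in>topspace E. \<forall>V. openin E V \<and> 0 \<in> V \<longrightarrow>
      (\<exists>U. openin E U \<and> x \<in> U \<and> (\<forall>T\<in>\<T>. \<forall>y\<in>U. T y - T x \<in> V)))"

definition power_bounded :: "'e::complex_vector topology \<Rightarrow> ('e \<Rightarrow> 'e) \<Rightarrow> bool" where
  "power_bounded E T \<longleftrightarrow>
    T \<in> continuous_linear_maps E \<and> equicontinuous E {T ^^ n | n. n \<ge> 0}"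

definition topologizable :: "'e::complex_vector topology \<Rightarrow> ('e \<Rightarrow> 'e) \<Rightarrow> bool" where
  "topologizable E T \<longleftrightarrow>
    T \<in> continuous_linear_maps E \<and>
    (\<forall>q\<in>continuous_seminorms E. \<exists>a::nat \<Rightarrow> real. \<exists>p\<in>continuous_seminorms E.
      (\<forall>n\<ge>1. a n > 0) \<and>
      (\<forall>x\<in>topspace E. \<forall>n\<ge>1. q (complex_of_real (a n) *\<^sub>C (T ^^ n) x) \<le> p x))"


section \<open>Holomorphic functions, the space of holomorphic functions on the unit ball\<close>

text \<open>Complex Frechet differentiability: the real Frechet derivative exists and is complex
  linear (\<open>has_derivative\<close> already makes it additive and bounded).\<close>

definition holomorphic_map_on :: "('a::complex_banach \<Rightarrow> 'b::complex_banach) \<Rightarrow> 'a set \<Rightarrow> bool" where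
  "holomorphic_map_on f U \<longleftrightarrow>
    (\<forall>x\<in>U. \<exists>f'. (f has_derivative f') (at x) \<and> (\<forall>c v. f' (c *\<^sub>C v) = c *\<^sub>C f' v))"

text \<open>Functions on the unit ball are represented by functions on the whole type vanishing off
  the ball, so that equality, the zero vector and the linear operations are those of functions on
  the ball.\<close>

definition holo_ball :: "('a::complex_banach \<Rightarrow> complex) set" where
  "holo_ball = {f. holomorphic_map_on f (ball 0 1) \<and> (\<forall>x. x \<notin> ball 0 1 \<longrightarrow> f x = 0)}"

text \<open>The topology of uniform convergence on compact subsets of the ball.\<close>

definition H_ball :: "('a::complex_banach \<Rightarrow> complex) topology" where
  "H_ball = topology (\<lambda>W. W \<subseteq> holo_ball \<and>
    (\<forall>f\<in>W. \<exists>K e. compact K \<and> K \<subseteq> ball 0 1 \<and> e > 0 \<and>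
      {g \<in> holo_ball. \<forall>x\<in>K. cmod (g x - f x) < e} \<subseteq> W))"

lemma openin_H_ball:
  fixes W :: "('a::complex_banach \<Rightarrow> complex) set"
  shows "openin H_ball W \<longleftrightarrow> W \<subseteq> holo_ball \<and>
    (\<forall>f\<in>W. \<exists>K e. compact K \<and> K \<subseteq> ball 0 1 \<and> e > 0 \<and>
      {g \<in> holo_ball. \<forall>x\<in>K. cmod (g x - f x) < e} \<subseteq> W)"
proof -
  define N where "N f K e = {g \<in> holo_ball. \<forall>x\<in>K. cmod (g x - f x) < e}"
    for f :: "'a \<Rightarrow> complex" and K e
  define P where "P f W \<longleftrightarrow> (\<exists>K e. compact K \<and> K \<subseteq> ball 0 1 \<and> e > 0 \<and> N f K e \<subseteq> W)"
    for f :: "'a \<Rightarrow> complex" and W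
  define Q where "Q W \<longleftrightarrow> W \<subseteq> holo_ball \<and> (\<forall>f\<in>W. P f W)" for W :: "('a \<Rightarrow> complex) set"
  have P_Int: "P f (S \<inter> T)" if S: "P f S" and T: "P f T" for f S T
  proof -
    obtain K d where K: "compact K" "K \<subseteq> ball 0 1" "d > 0" "N f K d \<subseteq> S"
      using S unfolding P_def by metis
    obtain L e where L: "compact L" "L \<subseteq> ball 0 1" "e > 0" "N f L e \<subseteq> T"
      using T unfolding P_def by metis
    have "N f (K \<union> L) (min d e) \<subseteq> N f K d" "N f (K \<union> L) (min d e) \<subseteq> N f L e"
      unfolding N_def by auto
    then have "N f (K \<union> L) (min d e) \<subseteq> S \<inter> T"
      using K(4) L(4) by (meson Int_greatest subset_trans)
    moreover have "compact (K \<union> L)" "K \<union> L \<subseteq> ball 0 1" "min d e > 0"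
      using K L by (simp_all add: compact_Un)
    ultimately show ?thesis
      unfolding P_def by metis
  qed
  have P_mono: "P f T" if "P f S" "S \<subseteq> T" for f S T
    using that unfolding P_def by (meson subset_trans)
  have Q_Int: "Q (S \<inter> T)" if S: "Q S" and T: "Q T" for S T
    unfolding Q_def
  proof (intro conjI ballI)
    show "S \<inter> T \<subseteq> holo_ball"
      using S unfolding Q_def by (meson Int_lower1 subset_trans)
    show "P f (S \<inter> T)" if "f \<in> S \<inter> T" for f
      using P_Int S T that unfolding Q_def by simp
  qed
  have Q_Union: "Q (\<Union>\<W>)" if W: "\<forall>W\<in>\<W>. Q W" for \<W>
    unfolding Q_def
  proof (intro conjI ballI)
    show "\<Union>\<W> \<subseteq> holo_ball"
      using W unfolding Q_def by (meson Union_least)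
    fix f assume "f \<in> \<Union>\<W>"
    then obtain W0 where W0: "W0 \<in> \<W>" "f \<in> W0" by (rule UnionE)
    then have "P f W0" using W unfolding Q_def by simp
    then show "P f (\<Union>\<W>)" using P_mono Union_upper[OF W0(1)] by simp
  qed
  have "istopology Q"
    unfolding istopology_def using Q_Int Q_Union by simp
  then have "openin (topology Q) = Q"
    by (rule topology_inverse')
  moreover have "H_ball = topology Q"
    unfolding H_ball_def Q_def P_def N_def ..
  ultimately have "openin H_ball W \<longleftrightarrow> Q W"
    by metis
  then show ?thesis
    unfolding Q_def P_def N_def .
qed

lemma topspace_H_ball: "topspace H_ball = holo_ball"
proof
  show "topspace H_ball \<subseteq> holo_ball"
    using openin_topspace[of H_ball] unfolding openin_H_ball by (rule conjunct1)
  have "openin H_ball holo_ball"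
    unfolding openin_H_ball
  proof (intro conjI ballI exI)
    show "compact {}" by simp
    show "(0::real) < 1" by simp
  qed auto
  then show "holo_ball \<subseteq> topspace H_ball"
    by (rule openin_subset)
qed


section \<open>Composition operators and stable orbits\<close>

definition composition_operator ::
    "('a::complex_banach \<Rightarrow> 'a) \<Rightarrow> ('a \<Rightarrow> complex) \<Rightarrow> 'a \<Rightarrow> complex" where
  "composition_operator \<phi> f = (\<lambda>x. if x \<in> ball 0 1 then f (\<phi> x) else 0)"

definition stable_orbits :: "'a::topological_space set \<Rightarrow> ('a \<Rightarrow> 'a) \<Rightarrow> bool" where
  "stable_orbits U f \<longleftrightarrow>
    (\<forall>K. compact K \<and> K \<subseteq> U \<longrightarrow>
      (\<exists>L. compact L \<and> L \<subseteq> U \<and> (\<forall>n\<ge>1. (f ^^ n) ` K \<subseteq> L)))"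

end

theory Submission
  imports Defs
begin

text \<open>
  If orbits are stable, then \<open>\<bar>C\<^sub>\<phi>^n f\<bar> = \<bar>f \<circ> \<phi>^n\<bar>\<close> on a compact set \<open>K\<close> is controlled by
  \<open>\<bar>f\<bar>\<close> on one compact set \<open>L\<close> for all \<open>n\<close>, so every family \<open>c n C\<^sub>\<phi>^n\<close> with \<open>\<bar>c n\<bar> \<le> 1\<close> is
  equicontinuous (\<open>stable_orbits_imp_equicontinuous\<close>). Conversely, if such a family with positive
  weights is equicontinuous, these weights show that \<open>C\<^sub>\<phi>\<close> is topologizable
  (\<open>equicontinuous_imp_topologizable\<close>). Weights \<open>1\<close> and \<open>1 / n\<close> give the two middle assertions.

  The substance is the way back from topologizability to stable orbits
  (\<open>topologizable_imp_stable_orbits\<close>). It yields a compact \<open>L\<close> with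
  \<open>sup\<^sub>K \<bar>f \<circ> \<phi>^n\<bar> \<le> M n * sup\<^sub>L \<bar>f\<bar>\<close> for all holomorphic \<open>f\<close>. The constant \<open>M n\<close> is
  harmless, since the estimate also holds for all powers of \<open>f\<close>: the points of \<open>\<phi>^n (K)\<close> lie in the
  holomorphic hull of \<open>L\<close>. Testing with exponentials of continuous linear functionals
  (\<open>exp_functional_holo_ball\<close>), which separate points from closed convex sets
  (\<open>separating_functional\<close>), shows that this hull is contained in the closed convex hull of \<open>L\<close>. In a
  Banach space the latter is compact (\<open>compact_closure_convex_hull\<close>), and it remains inside the open
  unit ball (\<open>closure_convex_hull_subset_ball\<close>).

  Separation rests on the Hahn--Banach theorem, obtained from the fact that minimal
  sublinear functionals are linear (\<open>minimal_sublinear_linear\<close>).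
\<close>

section \<open>Linear functionals below a sublinear one\<close>

definition sublinear :: "('a::real_vector \<Rightarrow> real) \<Rightarrow> bool" where
  "sublinear p \<longleftrightarrow> (\<forall>x y. p (x + y) \<le> p x + p y) \<and> (\<forall>t\<ge>0. \<forall>x. p (t *\<^sub>R x) \<le> t * p x)"

lemma sublinear_add: "sublinear p \<Longrightarrow> p (x + y) \<le> p x + p y"
  and sublinear_scale: "sublinear p \<Longrightarrow> 0 \<le> t \<Longrightarrow> p (t *\<^sub>R x) \<le> t * p x"
  by (simp_all add: sublinear_def)

lemma sublinear_minus:
  assumes "sublinear p" shows "- p (- x) \<le> p x"
proof -
  have "p 0 \<le> p x + p (- x)"
    using sublinear_add[OF assms, of x "- x"] by simp
  moreover have "p (0 + 0) \<le> p 0 + p 0"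
    by (rule sublinear_add[OF assms])
  ultimately show ?thesis by simp
qed

text \<open>For convex \<open>C\<close>, the largest sublinear functional that is at most \<open>p\<close> everywhere and at most \<open>- b\<close> on
  \<open>- C\<close>. A linear functional below it is below \<open>p\<close> and at least \<open>b\<close> on \<open>C\<close>. The hypothesis
  \<open>b \<le> p c\<close> for \<open>c \<in> C\<close> is what keeps the infimum finite.\<close>

definition tilt :: "('a::real_vector \<Rightarrow> real) \<Rightarrow> 'a set \<Rightarrow> real \<Rightarrow> 'a \<Rightarrow> real" where
  "tilt p C b x = (INF (t, c)\<in>{0..} \<times> C. p (x + t *\<^sub>R c) - t * b)"

locale tilting =
  fixes p :: "'a::real_vector \<Rightarrow> real" and C :: "'a set" and b :: real
  assumes p: "sublinear p" and C: "convex C" "C \<noteq> {}" and b: "\<And>c. c \<in> C \<Longrightarrow> b \<le> p c"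
begin

lemma tilt_bound:
  assumes "0 \<le> t" "c \<in> C" shows "- p (- x) \<le> p (x + t *\<^sub>R c) - t * b"
proof (cases "t = 0")
  case True then show ?thesis using sublinear_minus[OF p] by simp
next
  case False
  then have t: "t > 0" using assms by simp
  have "t * b \<le> t * p c"
    using b[OF assms(2)] assms by (simp add: mult_left_mono)
  also have "\<dots> = t * p (inverse t *\<^sub>R (t *\<^sub>R c))"
    using t by simp
  also have "\<dots> \<le> t * (inverse t * p (t *\<^sub>R c))"
    using t by (intro mult_left_mono sublinear_scale[OF p]) auto
  also have "\<dots> = p ((x + t *\<^sub>R c) + - x)"
    using t by simp
  also have "\<dots> \<le> p (x + t *\<^sub>R c) + p (- x)"
    by (rule sublinear_add[OF p])
  finally show ?thesis by simp
qed

lemma tilt_le: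
  assumes "0 \<le> t" "c \<in> C" shows "tilt p C b x \<le> p (x + t *\<^sub>R c) - t * b"
  unfolding tilt_def
  using assms tilt_bound[of _ _ x]
  by (intro cINF_lower2[where x = "(t, c)"] bdd_belowI2[where m = "- p (- x)"]) auto

lemma tilt_greatest:
  assumes "\<And>t c. 0 \<le> t \<Longrightarrow> c \<in> C \<Longrightarrow> m \<le> p (x + t *\<^sub>R c) - t * b"
  shows "m \<le> tilt p C b x"
  unfolding tilt_def using assms C by (intro cINF_greatest) auto

lemma tilt_le_self: "tilt p C b x \<le> p x"
  using C tilt_le[of 0] by auto

lemma tilt_minus_le: "c \<in> C \<Longrightarrow> tilt p C b (- c) \<le> - b"
  using tilt_le[of 1 c "- c"] sublinear_scale[OF p, of 0 0] by simp

lemma sublinear_tilt: "sublinear (tilt p C b)"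
  unfolding sublinear_def
proof (intro conjI allI impI)
  fix x y
  have "tilt p C b (x + y) - (p (y + t *\<^sub>R d) - t * b) \<le> p (x + s *\<^sub>R c) - s * b"
    if "0 \<le> t" "d \<in> C" "0 \<le> s" "c \<in> C" for s t c d
  proof (cases "s + t = 0")
    case True
    then have "s = 0" "t = 0" using that by auto
    then show ?thesis using tilt_le_self[of "x + y"] sublinear_add[OF p, of x y] by simp
  next
    case False
    \<comment> \<open>Convexity merges the two displacements \<open>s c\<close> and \<open>t d\<close> into the single one \<open>(s + t) e\<close>.\<close>
    define e where "e = (s / (s + t)) *\<^sub>R c + (t / (s + t)) *\<^sub>R d"
    have "e \<in> C"
      unfolding e_def using C that False
      by (intro convexD) (auto simp flip: add_divide_distrib)
    have "(s + t) *\<^sub>R e = s *\<^sub>R c + t *\<^sub>R d"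
      unfolding e_def using False by (simp add: scaleR_add_right)
    then have "tilt p C b (x + y) \<le> p ((x + s *\<^sub>R c) + (y + t *\<^sub>R d)) - (s + t) * b"
      using tilt_le[of "s + t" e "x + y"] that \<open>e \<in> C\<close> by (simp add: algebra_simps)
    then show ?thesis
      using sublinear_add[OF p, of "x + s *\<^sub>R c" "y + t *\<^sub>R d"] by (simp add: algebra_simps)
  qed
  then have "tilt p C b (x + y) - (p (y + t *\<^sub>R d) - t * b) \<le> tilt p C b x"
    if "0 \<le> t" "d \<in> C" for t d
    using that by (intro tilt_greatest) auto
  then have "tilt p C b (x + y) - tilt p C b x \<le> tilt p C b y"
    by (intro tilt_greatest) (simp add: algebra_simps)
  then show "tilt p C b (x + y) \<le> tilt p C b x + tilt p C b y" by simp
next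
  fix t :: real and x assume "0 \<le> t"
  show "tilt p C b (t *\<^sub>R x) \<le> t * tilt p C b x"
  proof (cases "t = 0")
    case True
    then show ?thesis using tilt_le_self[of 0] sublinear_scale[OF p, of 0 0] by simp
  next
    case False
    with \<open>0 \<le> t\<close> have t: "t > 0" by simp
    have "tilt p C b (t *\<^sub>R x) / t \<le> p (x + s *\<^sub>R c) - s * b" if "0 \<le> s" "c \<in> C" for s c
    proof -
      have "tilt p C b (t *\<^sub>R x) \<le> p (t *\<^sub>R (x + s *\<^sub>R c)) - (t * s) * b"
        using tilt_le[of "t * s" c "t *\<^sub>R x"] that t by (simp add: scaleR_add_right)
      also have "\<dots> \<le> t * p (x + s *\<^sub>R c) - (t * s) * b"
        using sublinear_scale[OF p, of t] t by simp
      finally show ?thesis using t by (simp add: field_simps)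
    qed
    then have "tilt p C b (t *\<^sub>R x) / t \<le> tilt p C b x"
      by (rule tilt_greatest)
    then show ?thesis using t by (simp add: field_simps)
  qed
qed

end

text \<open>The infimum is finite because all members of the chain lie above \<open>x \<mapsto> - p (- x)\<close>; it is
  subadditive because two members of a chain can be replaced by the smaller one.\<close>

lemma sublinear_INF_chain:
  assumes Q: "Q \<noteq> {}" "\<And>q. q \<in> Q \<Longrightarrow> sublinear q \<and> q \<le> p"
    and chain: "\<And>q r. q \<in> Q \<Longrightarrow> r \<in> Q \<Longrightarrow> q \<le> r \<or> r \<le> q"
  shows "sublinear (\<lambda>x. INF q\<in>Q. q x)" (is "sublinear ?m")
    and "\<And>q x. q \<in> Q \<Longrightarrow> (INF q\<in>Q. q x) \<le> q x"
proof -
  have "- p (- x) \<le> q x" if "q \<in> Q" for q x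
    using sublinear_minus[of q x] Q(2)[OF that] by (smt (verit) le_fun_def)
  then have "bdd_below ((\<lambda>q. q x) ` Q)" for x
    by (intro bdd_belowI2)
  then show lower: "?m x \<le> q x" if "q \<in> Q" for q x
    using that by (intro cINF_lower)
  have greatest: "k \<le> ?m x" if "\<And>q. q \<in> Q \<Longrightarrow> k \<le> q x" for k x
    using Q(1) that by (intro cINF_greatest) auto
  show "sublinear ?m"
    unfolding sublinear_def
  proof (intro conjI allI impI)
    fix x y
    have "?m (x + y) - r y \<le> q x" if qr: "q \<in> Q" "r \<in> Q" for q r
    proof -
      obtain s where s: "s \<in> Q" "s \<le> q" "s \<le> r"
        using chain[OF qr] qr by blast
      have "?m (x + y) \<le> s x + s y"
        using lower[OF s(1), of "x + y"] sublinear_add[of s x y] Q(2)[OF s(1)] by simp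
      then show ?thesis using le_funD[OF s(2), of x] le_funD[OF s(3), of y] by linarith
    qed
    then have "?m (x + y) - r y \<le> ?m x" if "r \<in> Q" for r
      using that by (intro greatest)
    then have "?m (x + y) - ?m x \<le> r y" if "r \<in> Q" for r
      using that by (simp add: algebra_simps)
    then have "?m (x + y) - ?m x \<le> ?m y"
      by (intro greatest)
    then show "?m (x + y) \<le> ?m x + ?m y" by simp
  next
    fix t :: real and x assume t: "0 \<le> t"
    show "?m (t *\<^sub>R x) \<le> t * ?m x"
    proof (cases "t = 0")
      case True
      obtain q where "q \<in> Q" using Q(1) by blast
      then show ?thesis
        using lower[of q 0] sublinear_scale[of q 0 0] Q(2) True by fastforce
    next
      case False
      have "?m (t *\<^sub>R x) / t \<le> q x" if "q \<in> Q" for q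
        using lower[OF that, of "t *\<^sub>R x"] sublinear_scale[of q t x] Q(2)[OF that] t False
        by (simp add: field_simps)
      then have "?m (t *\<^sub>R x) / t \<le> ?m x" by (rule greatest)
      then show ?thesis using t False by (simp add: field_simps)
    qed
  qed
qed

text \<open>Tilting \<open>q\<close> by the singleton \<open>{y}\<close> and the value \<open>q y\<close> gives a sublinear functional below \<open>q\<close>,
  which by minimality is \<open>q\<close> itself. So \<open>q (- y) \<le> - q y\<close>, and a sublinear functional
  that is odd is linear.\<close>

lemma minimal_sublinear_linear:
  assumes q: "sublinear q" and min: "\<And>r. sublinear r \<Longrightarrow> r \<le> q \<Longrightarrow> r = q"
  shows "linear q"
proof -
  have neg: "q (- y) = - q y" for y
  proof -
    interpret tilting q "{y}" "q y" by unfold_locales (auto simp: q)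
    have "tilt q {y} (q y) = q"
      by (rule min[OF sublinear_tilt]) (simp add: le_fun_def tilt_le_self)
    then have "q (- y) \<le> - q y"
      using tilt_minus_le[of y] by simp
    then show ?thesis
      using sublinear_minus[OF q, of y] by simp
  qed
  show ?thesis
  proof (rule linearI)
    fix x y
    have "q x \<le> q (x + y) + q (- y)"
      using sublinear_add[OF q, of "x + y" "- y"] by simp
    then show "q (x + y) = q x + q y"
      using sublinear_add[OF q, of x y] neg by simp
  next
    fix t :: real and x
    have *: "q (s *\<^sub>R x) = s * q x" if "s \<ge> 0" for s
      using sublinear_scale[OF q that, of x] sublinear_scale[OF q that, of "- x"] neg by simp
    show "q (t *\<^sub>R x) = t *\<^sub>R q x"
      using *[of t] *[of "- t"] neg[of "t *\<^sub>R x"] by (cases "t \<ge> 0") auto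
  qed
qed

text \<open>The analytic Hahn--Banach theorem in a form without partially defined functionals: Zorn's
  lemma yields a minimal sublinear functional below \<open>p\<close>.\<close>

lemma linear_below_sublinear:
  assumes p: "sublinear p"
  obtains u where "linear u" "u \<le> p"
proof -
  define S where "S = {q. sublinear q \<and> q \<le> p}"
  have po: "partial_order_on S (relation_of (\<lambda>q r. r \<le> q) S)"
    by (rule partial_order_on_relation_ofI) auto
  have "\<exists>u\<in>S. \<forall>q\<in>Q. u \<le> q" if Q: "Q \<in> Chains (relation_of (\<lambda>q r. r \<le> q) S)" for Q
  proof (cases "Q = {}")
    case True
    then show ?thesis using p by (auto simp: S_def)
  next
    case False
    have QS: "sublinear q \<and> q \<le> p" if "q \<in> Q" for q
      using Q that by (auto simp: Chains_def relation_of_def S_def)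
    have chain: "q \<le> r \<or> r \<le> q" if "q \<in> Q" "r \<in> Q" for q r
      using Q that by (auto simp: Chains_def relation_of_def)
    have m: "sublinear (\<lambda>x. INF q\<in>Q. q x)" "\<And>q x. q \<in> Q \<Longrightarrow> (INF q\<in>Q. q x) \<le> q x"
      using sublinear_INF_chain[OF False, of p] QS chain by simp_all
    obtain q where q: "q \<in> Q" using False by blast
    have "(\<lambda>x. INF q\<in>Q. q x) \<le> p"
    proof (rule le_funI)
      fix x show "(INF q\<in>Q. q x) \<le> p x"
        using m(2)[OF q, of x] QS[OF q] le_funD[of q p x] by linarith
    qed
    then have "(\<lambda>x. INF q\<in>Q. q x) \<in> S"
      using m(1) unfolding S_def by blast
    then show ?thesis
      by (intro bexI[where x = "\<lambda>x. INF q\<in>Q. q x"] ballI le_funI m(2))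
  qed
  then have "\<exists>u\<in>S. \<forall>q\<in>S. q \<le> u \<longrightarrow> q = u"
    by (rule predicate_Zorn[OF po])
  then obtain u where u: "u \<in> S" "\<And>q. q \<in> S \<Longrightarrow> q \<le> u \<Longrightarrow> q = u"
    by blast
  have "linear u"
  proof (rule minimal_sublinear_linear)
    show "sublinear u" using u(1) by (simp add: S_def)
    show "r = u" if "sublinear r" "r \<le> u" for r
      using u(1) that by (intro u(2)) (auto simp: S_def intro: order_trans)
  qed
  then show thesis using that u(1) by (simp add: S_def)
qed

text \<open>With \<open>d\<close> the distance of \<open>x\<close> to \<open>C\<close>, the norm is at least \<open>d\<close> on the convex set \<open>x - C\<close>. A linear
  functional below the tilted norm is then bounded by the norm and at least \<open>d\<close> on \<open>x - C\<close>.\<close>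

lemma separating_functional:
  fixes C :: "'a::real_normed_vector set"
  assumes C: "convex C" "C \<noteq> {}" and x: "x \<notin> closure C"
  obtains u d where "bounded_linear u" "(d::real) > 0" "\<And>c. c \<in> C \<Longrightarrow> u c \<le> u x - d"
proof -
  define d where "d = infdist x (closure C)"
  have d: "d > 0"
    unfolding d_def using assms by (intro infdist_pos_not_in_closed) auto
  interpret tilting norm "(\<lambda>c. x - c) ` C" d
  proof
    show "sublinear (norm :: 'a \<Rightarrow> real)"
      by (simp add: sublinear_def norm_triangle_ineq)
    have "(\<lambda>c. x - c) ` C = (\<lambda>c. x + c) ` (uminus ` C)" by (simp add: image_image)
    then show "convex ((\<lambda>c. x - c) ` C)"
      using C(1) by (simp add: convex_negations convex_translation)
    show "d \<le> norm e" if "e \<in> (\<lambda>c. x - c) ` C" for e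
      using that infdist_le[of _ "closure C" x] closure_subset[of C]
      by (auto simp: d_def dist_norm)
  qed (use C in auto)
  obtain u where u: "linear u" "u \<le> tilt norm ((\<lambda>c. x - c) ` C) d"
    using linear_below_sublinear[OF sublinear_tilt] by blast
  have le: "u v \<le> norm v" for v
    using le_funD[OF u(2)] tilt_le_self by (meson order_trans)
  have "norm (u v) \<le> norm v * 1" for v
    using le[of v] le[of "- v"] linear_neg[OF u(1), of v] by auto
  then have "bounded_linear u"
    by (rule bounded_linear_intro[OF linear_add[OF u(1)] linear_scale[OF u(1)]])
  moreover have "u c \<le> u x - d" if "c \<in> C" for c
  proof -
    have "u (- (x - c)) \<le> - d"
      using le_funD[OF u(2), of "- (x - c)"] tilt_minus_le[of "x - c"] that by auto
    then show ?thesis using linear_diff[OF u(1), of c x] by simp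
  qed
  ultimately show thesis using d that by blast
qed

section \<open>Closed convex hulls of compact sets\<close>

text \<open>Mazur's theorem. A finite \<open>e/3\<close>-net \<open>F\<close> of \<open>S\<close> makes \<open>convex hull F\<close> an \<open>e/3\<close>-net of \<open>convex hull S\<close>;
  being the hull of a finite set, it is compact and has a finite \<open>e/3\<close>-net itself.\<close>

lemma compact_closure_convex_hull:
  fixes S :: "'a::banach set"
  assumes "compact S"
  shows "compact (closure (convex hull S))"
  unfolding compact_eq_totally_bounded
proof (intro conjI allI impI)
  show "complete (closure (convex hull S))"
    by (simp add: complete_eq_closed)
  fix e :: real assume "e > 0"
  then have e: "e / 3 > 0" by simp
  obtain F where F: "finite F" "S \<subseteq> (\<Union>x\<in>F. ball x (e/3))"
    using assms e unfolding compact_eq_totally_bounded by blast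
  obtain G where G: "finite G" "convex hull F \<subseteq> (\<Union>x\<in>G. ball x (e/3))"
    using finite_imp_compact_convex_hull[OF F(1)] e unfolding compact_eq_totally_bounded by blast
  have "S \<subseteq> (\<Union>x\<in>convex hull F. \<Union>y\<in>ball 0 (e/3). {x + y})"
  proof
    fix s assume "s \<in> S"
    then obtain f where f: "f \<in> F" "s \<in> ball f (e/3)" using F(2) by blast
    then have "f \<in> convex hull F" "s - f \<in> ball 0 (e/3)" "s = f + (s - f)"
      by (auto simp: hull_inc dist_norm norm_minus_commute)
    then show "s \<in> (\<Union>x\<in>convex hull F. \<Union>y\<in>ball 0 (e/3). {x + y})" by blast
  qed
  then have sub: "convex hull S \<subseteq> (\<Union>x\<in>convex hull F. \<Union>y\<in>ball 0 (e/3). {x + y})"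
    by (intro hull_minimal convex_sums) auto
  have "closure (convex hull S) \<subseteq> (\<Union>x\<in>G. ball x e)"
  proof
    fix z assume "z \<in> closure (convex hull S)"
    then obtain s where s: "s \<in> convex hull S" "dist s z < e/3"
      using e closure_approachable by blast
    then obtain f y where f: "f \<in> convex hull F" "s = f + y" "norm y < e/3"
      using sub by fastforce
    then obtain g where g: "g \<in> G" "dist g f < e/3" using G(2) by auto
    have "dist g z \<le> dist g f + dist f s + dist s z"
      using dist_triangle[of g z f] dist_triangle[of f z s] by linarith
    also have "dist f s < e/3" using f by (simp add: dist_norm)
    finally have "dist g z < e" using s(2) g(2) by linarith
    then show "z \<in> (\<Union>x\<in>G. ball x e)" using g(1) by auto
  qed
  then show "\<exists>k. finite k \<and> closure (convex hull S) \<subseteq> (\<Union>x\<in>k. ball x e)"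
    using G(1) by blast
qed

text \<open>A compact subset of an open ball already lies in a smaller closed ball, which is closed and
  convex.\<close>

lemma closure_convex_hull_subset_ball:
  fixes S :: "'a::real_normed_vector set"
  assumes "compact S" "S \<subseteq> ball a r"
  shows "closure (convex hull S) \<subseteq> ball a r"
proof (cases "S = {}")
  case False
  then obtain m where m: "m \<in> S" "\<forall>s\<in>S. dist a s \<le> dist a m"
    using distance_attains_sup assms(1) by meson
  then have "closure (convex hull S) \<subseteq> cball a (dist a m)"
    by (intro closure_minimal hull_minimal) auto
  then show ?thesis using m(1) assms(2) by fastforce
qed simp

section \<open>Holomorphic functions on the unit ball\<close>

lemma holomorphic_map_on_continuous_on: "holomorphic_map_on f U \<Longrightarrow> continuous_on U f"
  unfolding holomorphic_map_on_def continuous_on_eq_continuous_within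
  by (meson continuous_at_imp_continuous_within has_derivative_continuous)

lemma holo_ball_continuous_on:
  "f \<in> holo_ball \<Longrightarrow> K \<subseteq> ball 0 1 \<Longrightarrow> continuous_on K f"
  unfolding holo_ball_def using holomorphic_map_on_continuous_on continuous_on_subset by blast

lemma holo_ballE:
  assumes "f \<in> holo_ball" "x \<in> ball 0 1"
  obtains D where "(f has_derivative D) (at x)" "\<And>c v. D (c *\<^sub>C v) = c *\<^sub>C D v"
proof -
  have "\<exists>D. (f has_derivative D) (at x) \<and> (\<forall>c v. D (c *\<^sub>C v) = c *\<^sub>C D v)"
    using assms by (simp add: holo_ball_def holomorphic_map_on_def)
  then show thesis using that by blast
qed

lemma holo_ball_add:
  assumes "f \<in> holo_ball" "g \<in> holo_ball" shows "f + g \<in> holo_ball"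
proof -
  have "\<exists>D. ((f + g) has_derivative D) (at x) \<and> (\<forall>c v. D (c *\<^sub>C v) = c *\<^sub>C D v)"
    if x: "x \<in> ball 0 1" for x
  proof -
    obtain D where D: "(f has_derivative D) (at x)" "\<And>c v. D (c *\<^sub>C v) = c *\<^sub>C D v"
      by (rule holo_ballE[OF assms(1) x]) blast
    obtain E where E: "(g has_derivative E) (at x)" "\<And>c v. E (c *\<^sub>C v) = c *\<^sub>C E v"
      by (rule holo_ballE[OF assms(2) x]) blast
    show ?thesis
      using has_derivative_add[OF D(1) E(1)]
      by (intro exI[where x = "\<lambda>v. D v + E v"])
        (simp add: plus_fun_def D(2) E(2) scaleC_add_right)
  qed
  then show ?thesis
    using assms by (simp add: holo_ball_def holomorphic_map_on_def)
qed

lemma holo_ball_scaleC: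
  assumes "f \<in> holo_ball" shows "a *\<^sub>C f \<in> holo_ball"
proof -
  have "\<exists>D. ((a *\<^sub>C f) has_derivative D) (at x) \<and> (\<forall>c v. D (c *\<^sub>C v) = c *\<^sub>C D v)"
    if x: "x \<in> ball 0 1" for x
  proof -
    obtain D where D: "(f has_derivative D) (at x)" "\<And>c v. D (c *\<^sub>C v) = c *\<^sub>C D v"
      by (rule holo_ballE[OF assms x]) blast
    show ?thesis
      using has_derivative_mult_right[OF D(1), of a]
      by (intro exI[where x = "\<lambda>v. a * D v"])
        (simp add: scaleC_fun_def scaleC_complex_def D(2))
  qed
  then show ?thesis
    using assms by (simp add: holo_ball_def holomorphic_map_on_def scaleC_fun_def scaleC_complex_def)
qed

lemma holo_ball_zero: "0 \<in> holo_ball"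
  by (auto simp: holo_ball_def holomorphic_map_on_def zero_fun_def scaleC_complex_def
      intro!: exI[where x = "\<lambda>_. 0"])

lemma holo_ball_restrict:
  assumes "holomorphic_map_on f (ball 0 1)"
  shows "(\<lambda>x. if x \<in> ball 0 1 then f x else 0) \<in> holo_ball"
  unfolding holo_ball_def holomorphic_map_on_def
proof safe
  fix x :: 'a assume x: "x \<in> ball 0 1"
  obtain D where D: "(f has_derivative D) (at x)" "\<forall>c v. D (c *\<^sub>C v) = c *\<^sub>C D v"
    using assms x unfolding holomorphic_map_on_def by blast
  have "((\<lambda>x. if x \<in> ball 0 1 then f x else 0) has_derivative D) (at x)"
    by (rule has_derivative_transform_within_open[OF D(1) open_ball x]) simp
  then show "\<exists>D. ((\<lambda>x. if x \<in> ball 0 1 then f x else 0) has_derivative D) (at x) \<and>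
      (\<forall>c v. D (c *\<^sub>C v) = c *\<^sub>C D v)"
    using D(2) by blast
qed simp

lemma composition_operator_holo_ball:
  assumes "holomorphic_map_on \<phi> (ball 0 1)" "\<phi> ` ball 0 1 \<subseteq> ball 0 1" "f \<in> holo_ball"
  shows "composition_operator \<phi> f \<in> holo_ball"
proof -
  have "\<exists>D. ((\<lambda>x. f (\<phi> x)) has_derivative D) (at x) \<and> (\<forall>c v. D (c *\<^sub>C v) = c *\<^sub>C D v)"
    if x: "x \<in> ball 0 1" for x
  proof -
    have "\<phi> x \<in> ball 0 1" using assms(2) x by blast
    then obtain D where D: "(f has_derivative D) (at (\<phi> x))" "\<And>c v. D (c *\<^sub>C v) = c *\<^sub>C D v"
      by (rule holo_ballE[OF assms(3)]) blast
    obtain E where E: "(\<phi> has_derivative E) (at x)" "\<And>c v. E (c *\<^sub>C v) = c *\<^sub>C E v"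
      using x assms(1) unfolding holomorphic_map_on_def by blast
    show ?thesis
      using diff_chain_at[OF E(1) D(1)] D(2) E(2)
      by (intro exI[where x = "D \<circ> E"]) (simp add: o_def)
  qed
  then have "holomorphic_map_on (\<lambda>x. f (\<phi> x)) (ball 0 1)"
    by (simp add: holomorphic_map_on_def)
  then show ?thesis
    unfolding composition_operator_def by (rule holo_ball_restrict)
qed

text \<open>The real functional \<open>u\<close> is the real part of the complex linear functional
  \<open>h z = u z - \<i> u (\<i> z)\<close>, so \<open>exp (h z)\<close> is a holomorphic function with modulus \<open>exp (u z)\<close>.\<close>

lemma exp_functional_holo_ball:
  fixes u :: "'a::complex_banach \<Rightarrow> real"
  assumes "bounded_linear u"
  obtains f where "f \<in> holo_ball" "\<And>z. z \<in> ball 0 1 \<Longrightarrow> cmod (f z) = exp (u z)"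
proof -
  interpret u: bounded_linear u by fact
  have i_scaleR: "\<i> *\<^sub>C (r *\<^sub>R z) = r *\<^sub>R (\<i> *\<^sub>C z)" for r and z :: 'a
    by (simp add: scaleR_scaleC scaleC_scaleC mult.commute)
  have bl_i: "bounded_linear (\<lambda>z::'a. \<i> *\<^sub>C z)"
    by (rule bounded_linear_intro[where K = 1])
      (simp_all add: scaleC_add_right i_scaleR norm_scaleC)
  define h where "h z = complex_of_real (u z) - \<i> * complex_of_real (u (\<i> *\<^sub>C z))" for z
  have bl_h: "bounded_linear h"
    unfolding h_def
    by (intro bounded_linear_sub bounded_linear_compose[OF bounded_linear_mult_right]
        bounded_linear_compose[OF bounded_linear_of_real] u.bounded_linear_axioms
        bounded_linear_compose[OF u.bounded_linear_axioms bl_i])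
  have split: "c *\<^sub>C z = Re c *\<^sub>R z + Im c *\<^sub>R (\<i> *\<^sub>C z)" for c and z :: 'a
  proof -
    have "c = complex_of_real (Re c) + complex_of_real (Im c) * \<i>"
      by (simp add: complex_eq_iff)
    then have "c *\<^sub>C z = (complex_of_real (Re c) + complex_of_real (Im c) * \<i>) *\<^sub>C z"
      by (rule arg_cong)
    then show ?thesis
      by (simp only: scaleC_add_left scaleC_scaleC scaleR_scaleC)
  qed
  have ii: "\<i> *\<^sub>C \<i> *\<^sub>C z = - z" for z :: 'a
  proof -
    have "\<i> *\<^sub>C \<i> *\<^sub>C z = complex_of_real (- 1) *\<^sub>C z" by (simp add: scaleC_scaleC)
    also have "\<dots> = (- 1) *\<^sub>R z" by (rule scaleR_scaleC[symmetric])
    finally show ?thesis by simp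
  qed
  have h_scaleC: "h (c *\<^sub>C z) = c * h z" for c z
  proof -
    have "u (c *\<^sub>C z) = Re c * u z + Im c * u (\<i> *\<^sub>C z)"
      unfolding split[of c z] by (simp add: u.add u.scaleR)
    moreover have "u (\<i> *\<^sub>C c *\<^sub>C z) = Re c * u (\<i> *\<^sub>C z) - Im c * u z"
      unfolding split[of c z] by (simp add: scaleC_add_right i_scaleR ii u.add u.scaleR u.diff linear_neg[OF u.linear])
    ultimately show ?thesis
      unfolding h_def by (simp add: complex_eq_iff)
  qed
  have "((\<lambda>z. exp (h z)) has_derivative (\<lambda>v. exp (h z) * h v)) (at z)" for z
    using has_derivative_compose[OF bounded_linear_imp_has_derivative[OF bl_h]
        DERIV_exp[of "h z", unfolded has_field_derivative_def], of UNIV] .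
  then have "holomorphic_map_on (\<lambda>z. exp (h z)) (ball 0 1)"
    unfolding holomorphic_map_on_def
    by (intro ballI exI[where x = "\<lambda>v. exp (h _) * h v"]) (auto simp: h_scaleC scaleC_complex_def)
  then have "(\<lambda>z. if z \<in> ball 0 1 then exp (h z) else 0) \<in> holo_ball"
    by (rule holo_ball_restrict)
  moreover have "cmod (exp (h z)) = exp (u z)" for z
    by (simp add: h_def)
  ultimately show thesis
    using that[of "\<lambda>z. if z \<in> ball 0 1 then exp (h z) else 0"] by simp
qed

section \<open>The compact-open topology\<close>

definition sup_on :: "'a set \<Rightarrow> ('a \<Rightarrow> complex) \<Rightarrow> real" where
  "sup_on K f = (SUP x\<in>K. cmod (f x))"

lemma sup_on_upper:
  assumes "compact K" "K \<subseteq> ball 0 1" "f \<in> holo_ball" "x \<in> K"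
  shows "cmod (f x) \<le> sup_on K f"
proof -
  have "compact ((\<lambda>x. cmod (f x)) ` K)"
    using assms by (intro compact_continuous_image continuous_intros holo_ball_continuous_on)
  then show ?thesis
    unfolding sup_on_def using assms(4)
    by (intro cSUP_upper) (auto intro: bounded_imp_bdd_above compact_imp_bounded)
qed

lemma sup_on_least: "K \<noteq> {} \<Longrightarrow> (\<And>x. x \<in> K \<Longrightarrow> cmod (f x) \<le> M) \<Longrightarrow> sup_on K f \<le> M"
  unfolding sup_on_def by (rule cSUP_least)

lemma sup_on_nonneg:
  assumes "compact K" "K \<subseteq> ball 0 1" "K \<noteq> {}" "f \<in> holo_ball"
  shows "0 \<le> sup_on K f"
proof -
  obtain x where "x \<in> K" using assms(3) by blast
  then have "cmod (f x) \<le> sup_on K f"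
    by (rule sup_on_upper[OF assms(1,2,4)])
  then show ?thesis
    by (rule order_trans[OF norm_ge_zero])
qed

text \<open>The maximum of \<open>\<bar>g - f\<bar>\<close> on the compact set \<open>K\<close> is attained, hence stays strictly
  below \<open>e\<close> and leaves room around \<open>g\<close>.\<close>

lemma openin_H_ball_nbhd:
  assumes K: "compact K" "K \<subseteq> ball 0 1" and f: "f \<in> holo_ball"
  shows "openin H_ball {g \<in> holo_ball. \<forall>x\<in>K. cmod (g x - f x) < e}" (is "openin _ ?N")
  unfolding openin_H_ball
proof (intro conjI ballI)
  fix g assume g: "g \<in> ?N"
  show "\<exists>K' d. compact K' \<and> K' \<subseteq> ball 0 1 \<and> d > 0 \<and>
      {k \<in> holo_ball. \<forall>x\<in>K'. cmod (k x - g x) < d} \<subseteq> ?N"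
  proof (cases "K = {}")
    case True
    then show ?thesis by (intro exI[where x = "{}"] exI[where x = 1]) auto
  next
    case False
    have "continuous_on K (\<lambda>x. cmod (g x - f x))"
      using K f g by (intro continuous_intros holo_ball_continuous_on) auto
    then obtain m where m: "m \<in> K" "\<And>x. x \<in> K \<Longrightarrow> cmod (g x - f x) \<le> cmod (g m - f m)"
      using continuous_attains_sup[OF K(1) False] by blast
    define d where "d = e - cmod (g m - f m)"
    have "d > 0" using g m(1) by (simp add: d_def)
    moreover have "cmod (k x - f x) < e" if "x \<in> K" "cmod (k x - g x) < d" for k x
      using norm_triangle_ineq[of "k x - g x" "g x - f x"] that m(2)[OF that(1)]
      by (simp add: d_def)
    ultimately show ?thesis
      using K by (intro exI[where x = K] exI[where x = d]) auto
  qed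
qed auto

text \<open>The compact set can be taken nonempty, which makes its supremum a genuine seminorm.\<close>

lemma openin_H_ballE:
  assumes "openin H_ball W" "f \<in> W"
  obtains K e where "compact K" "K \<subseteq> ball 0 1" "K \<noteq> {}" "e > 0"
    "\<And>g. g \<in> holo_ball \<Longrightarrow> (\<And>x. x \<in> K \<Longrightarrow> cmod (g x - f x) < e) \<Longrightarrow> g \<in> W"
proof -
  obtain K e where K: "compact K" "K \<subseteq> ball 0 1" "e > 0"
    "{g \<in> holo_ball. \<forall>x\<in>K. cmod (g x - f x) < e} \<subseteq> W"
    using assms bspec[of W _ f] unfolding openin_H_ball by blast
  show thesis
    by (rule that[of "insert 0 K" e]) (use K in auto)
qed

lemma sup_on_add_le:
  assumes "compact K" "K \<subseteq> ball 0 1" "K \<noteq> {}" "f \<in> holo_ball" "g \<in> holo_ball"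
  shows "sup_on K (f + g) \<le> sup_on K f + sup_on K g"
proof (rule sup_on_least[OF assms(3)])
  fix x assume x: "x \<in> K"
  show "cmod ((f + g) x) \<le> sup_on K f + sup_on K g"
    using sup_on_upper[OF assms(1,2,4) x] sup_on_upper[OF assms(1,2,5) x]
      norm_triangle_ineq[of "f x" "g x"] by simp
qed

lemma sup_on_scaleC:
  assumes K: "compact K" "K \<subseteq> ball 0 1" "K \<noteq> {}" "f \<in> holo_ball"
  shows "sup_on K (c *\<^sub>C f) = cmod c * sup_on K f"
proof -
  have le: "sup_on K (a *\<^sub>C g) \<le> cmod a * sup_on K g" if "g \<in> holo_ball" for a g
    using sup_on_upper[OF K(1,2) that] K(3)
    by (intro sup_on_least)
      (auto simp: scaleC_fun_def scaleC_complex_def norm_mult intro: mult_left_mono)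
  show ?thesis
  proof (cases "c = 0")
    case True
    then have "c *\<^sub>C f = (\<lambda>_. 0)" by (simp add: scaleC_fun_def scaleC_complex_def)
    then show ?thesis using True K(3) by (simp add: sup_on_def)
  next
    case False
    have "sup_on K f = sup_on K (inverse c *\<^sub>C c *\<^sub>C f)"
      using False by (simp add: scaleC_scaleC scaleC_one)
    also have "\<dots> \<le> cmod (inverse c) * sup_on K (c *\<^sub>C f)"
      by (rule le[OF holo_ball_scaleC[OF K(4)]])
    finally show ?thesis
      using le[OF K(4), of c] False by (simp add: norm_divide field_simps)
  qed
qed

lemma sup_on_continuous_seminorm:
  fixes K :: "'a::complex_banach set"
  assumes K: "compact K" "K \<subseteq> ball 0 1" "K \<noteq> {}" and r: "r \<ge> 0"
  shows "(\<lambda>f. r * sup_on K f) \<in> continuous_seminorms H_ball"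
  unfolding continuous_seminorms_def mem_Collect_eq topspace_H_ball
proof (intro conjI ballI allI)
  have "openin H_ball {f \<in> holo_ball. sup_on K f \<in> W}" if W: "open W" for W
    unfolding openin_H_ball
  proof (intro conjI ballI)
    fix f assume f: "f \<in> {f \<in> holo_ball. sup_on K f \<in> W}"
    then have "f \<in> holo_ball" "sup_on K f \<in> W" by auto
    then obtain e where e: "e > 0" "\<And>s. dist s (sup_on K f) < e \<Longrightarrow> s \<in> W"
      using openE[OF W] by (metis dist_commute mem_ball subsetD)
    have "sup_on K g \<in> W"
      if g: "g \<in> holo_ball" and close: "\<forall>x\<in>K. cmod (g x - f x) < e / 2" for g
    proof -
      have "sup_on K g \<le> sup_on K f + e / 2"
      proof (rule sup_on_least[OF K(3)])
        fix x assume x: "x \<in> K"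
        show "cmod (g x) \<le> sup_on K f + e / 2"
          using sup_on_upper[OF K(1,2) \<open>f \<in> holo_ball\<close> x] bspec[OF close x]
            norm_triangle_ineq2[of "g x" "f x"] by linarith
      qed
      moreover have "sup_on K f \<le> sup_on K g + e / 2"
      proof (rule sup_on_least[OF K(3)])
        fix x assume x: "x \<in> K"
        show "cmod (f x) \<le> sup_on K g + e / 2"
          using sup_on_upper[OF K(1,2) g x] bspec[OF close x]
            norm_triangle_ineq2[of "f x" "g x"] norm_minus_commute[of "f x" "g x"] by linarith
      qed
      ultimately have "dist (sup_on K g) (sup_on K f) < e"
        using e(1) unfolding dist_real_def by linarith
      then show ?thesis by (rule e(2))
    qed
    then have "{g \<in> holo_ball. \<forall>x\<in>K. cmod (g x - f x) < e / 2} \<subseteq> {f \<in> holo_ball. sup_on K f \<in> W}"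
      by blast
    then show "\<exists>K' d. compact K' \<and> K' \<subseteq> ball 0 1 \<and> d > 0 \<and>
        {g \<in> holo_ball. \<forall>x\<in>K'. cmod (g x - f x) < d} \<subseteq> {f \<in> holo_ball. sup_on K f \<in> W}"
      using K(1,2) half_gt_zero[OF e(1)] by blast
  qed auto
  then have "continuous_map H_ball euclideanreal (sup_on K)"
    by (simp add: continuous_map_def topspace_H_ball)
  then show "continuous_map H_ball euclideanreal (\<lambda>f. r * sup_on K f)"
    by (intro continuous_map_real_mult) auto
next
  fix f :: "'a \<Rightarrow> complex" assume f: "f \<in> holo_ball"
  show "0 \<le> r * sup_on K f" using r sup_on_nonneg[OF K f] by simp
next
  fix f g :: "'a \<Rightarrow> complex" assume "f \<in> holo_ball" "g \<in> holo_ball"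
  then show "r * sup_on K (f + g) \<le> r * sup_on K f + r * sup_on K g"
    using mult_left_mono[OF sup_on_add_le[OF K] r] by (simp add: distrib_left)
next
  fix c and f :: "'a \<Rightarrow> complex" assume "f \<in> holo_ball"
  then show "r * sup_on K (c *\<^sub>C f) = cmod c * (r * sup_on K f)"
    using sup_on_scaleC[OF K] by simp
qed

text \<open>Scaling: for \<open>s > sup_on K f / e\<close> the function \<open>f / s\<close> is smaller than \<open>e\<close> on \<open>K\<close>. This turns
  a zero neighbourhood on which \<open>q\<close> is small into an explicit seminorm that dominates \<open>q\<close>.\<close>

lemma homogeneous_le_sup_on:
  fixes q :: "('a::complex_banach \<Rightarrow> complex) \<Rightarrow> real"
  assumes K: "compact K" "K \<subseteq> ball 0 1" "K \<noteq> {}" and e: "e > 0"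
    and hom: "\<And>c f. f \<in> holo_ball \<Longrightarrow> q (c *\<^sub>C f) = cmod c * q f"
    and small: "\<And>f. f \<in> holo_ball \<Longrightarrow> (\<And>x. x \<in> K \<Longrightarrow> cmod (f x) < e) \<Longrightarrow> q f < 1"
    and f: "f \<in> holo_ball"
  shows "q f \<le> 1 / e * sup_on K f"
proof (rule dense_ge)
  fix s assume s: "1 / e * sup_on K f < s"
  have "0 \<le> 1 / e * sup_on K f"
    using sup_on_nonneg[OF K f] e by simp
  then have "s > 0" using s by linarith
  have "cmod ((complex_of_real (1 / s) *\<^sub>C f) x) < e" if "x \<in> K" for x
    using sup_on_upper[OF K(1,2) f that] s e \<open>s > 0\<close>
    by (simp add: scaleC_fun_def scaleC_complex_def norm_mult norm_divide field_simps)
  then have "q (complex_of_real (1 / s) *\<^sub>C f) < 1"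
    by (intro small holo_ball_scaleC f)
  moreover have "q (complex_of_real (1 / s) *\<^sub>C f) = q f / s"
    using hom[OF f, of "complex_of_real (1 / s)"] \<open>s > 0\<close> by (simp add: norm_divide)
  ultimately show "q f \<le> s"
    using \<open>s > 0\<close> by (simp add: divide_less_eq)
qed

section \<open>Iterates of a composition operator\<close>

text \<open>If the values of \<open>T f\<close> on \<open>K\<close> are controlled by those of \<open>f\<close> on one compact \<open>L\<close> for
  all \<open>T\<close> of the family, linearity lets the bound act on differences \<open>g - f\<close>. The same estimate
  gives the continuity of the single operators and the equicontinuity of the family.\<close>

lemma equicontinuous_H_ball_of_domination:
  fixes \<T> :: "(('a::complex_banach \<Rightarrow> complex) \<Rightarrow> ('a \<Rightarrow> complex)) set"
  assumes into: "\<And>T f. T \<in> \<T> \<Longrightarrow> f \<in> holo_ball \<Longrightarrow> T f \<in> holo_ball"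
    and add: "\<And>T f g. T \<in> \<T> \<Longrightarrow> f \<in> holo_ball \<Longrightarrow> g \<in> holo_ball \<Longrightarrow> T (f + g) = T f + T g"
    and scale: "\<And>T c f. T \<in> \<T> \<Longrightarrow> f \<in> holo_ball \<Longrightarrow> T (c *\<^sub>C f) = c *\<^sub>C T f"
    and dom: "\<And>K. compact K \<Longrightarrow> K \<subseteq> ball 0 1 \<Longrightarrow> \<exists>L. compact L \<and> L \<subseteq> ball 0 1 \<and>
      (\<forall>T\<in>\<T>. \<forall>f\<in>holo_ball. \<forall>x\<in>K. \<exists>y\<in>L. cmod (T f x) \<le> cmod (f y))"
  shows "equicontinuous H_ball \<T>"
proof -
  have uniform: "\<exists>L. compact L \<and> L \<subseteq> ball 0 1 \<and> (\<forall>T\<in>\<T>. \<forall>g\<in>holo_ball. \<forall>f\<in>holo_ball.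
      (\<forall>x\<in>L. cmod (g x - f x) < e) \<longrightarrow> (\<forall>x\<in>K. cmod (T g x - T f x) < e))"
    if K: "compact K" "K \<subseteq> ball 0 1" for K and e :: real
  proof -
    obtain L where L: "compact L" "L \<subseteq> ball 0 1"
      and LT: "\<And>T f x. T \<in> \<T> \<Longrightarrow> f \<in> holo_ball \<Longrightarrow> x \<in> K \<Longrightarrow> \<exists>y\<in>L. cmod (T f x) \<le> cmod (f y)"
      using dom[OF K] by blast
    have "cmod (T g x - T f x) < e"
      if T: "T \<in> \<T>" and g: "g \<in> holo_ball" and f: "f \<in> holo_ball"
        and close: "\<forall>x\<in>L. cmod (g x - f x) < e" and x: "x \<in> K" for T g f x
    proof -
      let ?d = "g + (- 1) *\<^sub>C f"
      have "?d \<in> holo_ball"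
        by (rule holo_ball_add[OF g holo_ball_scaleC[OF f]])
      then obtain y where y: "y \<in> L" "cmod (T ?d x) \<le> cmod (?d y)"
        using LT[OF T _ x] by blast
      have "T ?d = T g + (- 1) *\<^sub>C T f"
        by (simp only: add[OF T g holo_ball_scaleC[OF f]] scale[OF T f])
      then have "T ?d x = T g x - T f x"
        by (simp add: scaleC_fun_def scaleC_complex_def)
      moreover have "?d y = g y - f y"
        by (simp add: scaleC_fun_def scaleC_complex_def)
      ultimately show ?thesis
        using y close by (simp add: order_le_less_trans)
    qed
    then show ?thesis using L by blast
  qed
  have "continuous_map H_ball H_ball T" if T: "T \<in> \<T>" for T
    unfolding continuous_map_def topspace_H_ball
  proof (intro conjI allI impI)
    show "T \<in> holo_ball \<rightarrow> holo_ball" using into[OF T] by blast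
    fix W :: "('a \<Rightarrow> complex) set" assume W: "openin H_ball W"
    show "openin H_ball {f \<in> holo_ball. T f \<in> W}"
      unfolding openin_H_ball
    proof (intro conjI ballI)
      fix f assume f: "f \<in> {f \<in> holo_ball. T f \<in> W}"
      then obtain K e where K: "compact K" "K \<subseteq> ball 0 1" "K \<noteq> {}" "e > 0"
        and KW: "\<And>g. g \<in> holo_ball \<Longrightarrow> (\<And>x. x \<in> K \<Longrightarrow> cmod (g x - T f x) < e) \<Longrightarrow> g \<in> W"
        using openin_H_ballE[OF W, of "T f"] by blast
      obtain L where L: "compact L" "L \<subseteq> ball 0 1"
        and "\<forall>T\<in>\<T>. \<forall>g\<in>holo_ball. \<forall>f\<in>holo_ball.
          (\<forall>x\<in>L. cmod (g x - f x) < e) \<longrightarrow> (\<forall>x\<in>K. cmod (T g x - T f x) < e)"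
        using uniform[OF K(1,2), of e] by blast
      then have "{g \<in> holo_ball. \<forall>x\<in>L. cmod (g x - f x) < e} \<subseteq> {f \<in> holo_ball. T f \<in> W}"
        using f T into KW by auto
      then show "\<exists>K' d. compact K' \<and> K' \<subseteq> ball 0 1 \<and> d > 0 \<and>
          {g \<in> holo_ball. \<forall>x\<in>K'. cmod (g x - f x) < d} \<subseteq> {f \<in> holo_ball. T f \<in> W}"
        using L K(4) by blast
    qed auto
  qed
  then have "\<T> \<subseteq> continuous_linear_maps H_ball"
    by (auto simp: continuous_linear_maps_def topspace_H_ball add scale)
  moreover have "\<exists>U. openin H_ball U \<and> f \<in> U \<and> (\<forall>T\<in>\<T>. \<forall>g\<in>U. T g - T f \<in> V)"
    if f: "f \<in> holo_ball" and V: "openin H_ball V" "0 \<in> V" for f V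
  proof -
    obtain K e where K: "compact K" "K \<subseteq> ball 0 1" "K \<noteq> {}" "e > 0"
      and KV: "\<And>g. g \<in> holo_ball \<Longrightarrow> (\<And>x. x \<in> K \<Longrightarrow> cmod (g x - 0 x) < e) \<Longrightarrow> g \<in> V"
      using openin_H_ballE[OF V] by blast
    obtain L where L: "compact L" "L \<subseteq> ball 0 1"
      and LT: "\<And>T g f x. T \<in> \<T> \<Longrightarrow> g \<in> holo_ball \<Longrightarrow> f \<in> holo_ball \<Longrightarrow>
        (\<forall>x\<in>L. cmod (g x - f x) < e) \<Longrightarrow> x \<in> K \<Longrightarrow> cmod (T g x - T f x) < e"
      using uniform[OF K(1,2), of e] by metis
    have "T g - T f \<in> V"
      if T: "T \<in> \<T>" and g: "g \<in> holo_ball" and close: "\<forall>x\<in>L. cmod (g x - f x) < e" for T g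
    proof (rule KV)
      have "T g - T f = T g + (- 1) *\<^sub>C T f"
        by (simp add: fun_eq_iff scaleC_fun_def scaleC_complex_def)
      also have "\<dots> \<in> holo_ball"
        by (rule holo_ball_add[OF into[OF T g] holo_ball_scaleC[OF into[OF T f]]])
      finally show "T g - T f \<in> holo_ball" .
      show "cmod ((T g - T f) x - 0 x) < e" if "x \<in> K" for x
        using LT[OF T g f close that] by simp
    qed
    then show ?thesis
      using openin_H_ball_nbhd[OF L f, of e] f K(4)
      by (intro exI[where x = "{g \<in> holo_ball. \<forall>x\<in>L. cmod (g x - f x) < e}"]) auto
  qed
  ultimately show ?thesis
    by (simp add: equicontinuous_def topspace_H_ball)
qed

locale holomorphic_self_map =
  fixes \<phi> :: "'a::complex_banach \<Rightarrow> 'a"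
  assumes holomorphic: "holomorphic_map_on \<phi> (ball 0 1)"
    and self_map: "\<phi> ` ball 0 1 \<subseteq> ball 0 1"
begin

abbreviation C where "C \<equiv> composition_operator \<phi>"

lemma iterate_in_ball: "x \<in> ball 0 1 \<Longrightarrow> (\<phi> ^^ n) x \<in> ball 0 1"
  using self_map by (induction n) (simp_all add: image_subset_iff)

lemma C_power_apply: "x \<in> ball 0 1 \<Longrightarrow> (C ^^ n) f x = f ((\<phi> ^^ n) x)"
proof (induction n arbitrary: x)
  case (Suc n)
  then have "\<phi> x \<in> ball 0 1" using self_map by blast
  then have "(C ^^ n) f (\<phi> x) = f ((\<phi> ^^ n) (\<phi> x))" by (rule Suc.IH)
  then show ?case
    using Suc.prems composition_operator_def[of \<phi> "(C ^^ n) f"] by (simp add: funpow_swap1)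
qed simp

lemma C_power_holo_ball: "f \<in> holo_ball \<Longrightarrow> (C ^^ n) f \<in> holo_ball"
  by (induction n) (auto intro: composition_operator_holo_ball[OF holomorphic self_map])

lemma C_power_add: "(C ^^ n) (f + g) = (C ^^ n) f + (C ^^ n) g"
  by (induction n) (auto simp: composition_operator_def fun_eq_iff)

lemma C_power_scaleC: "(C ^^ n) (c *\<^sub>C f) = c *\<^sub>C (C ^^ n) f"
  by (induction n) (auto simp: composition_operator_def fun_eq_iff scaleC_fun_def scaleC_complex_def)

lemma equicontinuous_C_powers:
  assumes c: "\<And>n. n \<in> I \<Longrightarrow> cmod (c n) \<le> 1"
    and orbits: "\<And>K. compact K \<Longrightarrow> K \<subseteq> ball 0 1 \<Longrightarrow>
      \<exists>L. compact L \<and> L \<subseteq> ball 0 1 \<and> (\<forall>n\<in>I. (\<phi> ^^ n) ` K \<subseteq> L)"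
  shows "equicontinuous H_ball {(\<lambda>f. c n *\<^sub>C (C ^^ n) f) | n. n \<in> I}"
proof (rule equicontinuous_H_ball_of_domination)
  fix K :: "'a set" assume K: "compact K" "K \<subseteq> ball 0 1"
  obtain L where L: "compact L" "L \<subseteq> ball 0 1" "\<forall>n\<in>I. (\<phi> ^^ n) ` K \<subseteq> L"
    using orbits[OF K] by blast
  have "cmod ((c n *\<^sub>C (C ^^ n) f) x) \<le> cmod (f ((\<phi> ^^ n) x)) \<and> (\<phi> ^^ n) x \<in> L"
    if "n \<in> I" "x \<in> K" for n f x
  proof -
    have "(c n *\<^sub>C (C ^^ n) f) x = c n * f ((\<phi> ^^ n) x)"
      using C_power_apply[of x n f] K(2) that(2) by (auto simp: scaleC_fun_def scaleC_complex_def)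
    then show ?thesis
      using c[OF that(1)] L(3) that by (auto simp: norm_mult mult_left_le_one_le)
  qed
  then show "\<exists>L. compact L \<and> L \<subseteq> ball 0 1 \<and>
      (\<forall>T\<in>{(\<lambda>f. c n *\<^sub>C (C ^^ n) f) | n. n \<in> I}. \<forall>f\<in>holo_ball. \<forall>x\<in>K.
        \<exists>y\<in>L. cmod (T f x) \<le> cmod (f y))"
    using L(1,2) by (intro exI[where x = L]) blast
next
  fix T and f :: "'a \<Rightarrow> complex" and a
  assume "T \<in> {(\<lambda>f. c n *\<^sub>C (C ^^ n) f) | n. n \<in> I}"
  then obtain n where n: "T = (\<lambda>f. c n *\<^sub>C (C ^^ n) f)" by blast
  show "T f \<in> holo_ball" if "f \<in> holo_ball"
    unfolding n by (rule holo_ball_scaleC[OF C_power_holo_ball[OF that]])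
  show "T (f + g) = T f + T g" for g
    unfolding n C_power_add by (rule scaleC_add_right)
  show "T (a *\<^sub>C f) = a *\<^sub>C T f"
    unfolding n C_power_scaleC by (simp add: scaleC_scaleC mult.commute)
qed

text \<open>The family consisting of \<open>C\<close> alone is dominated on \<open>K\<close> by the compact image \<open>\<phi> ` K\<close>.\<close>

lemma C_continuous_linear: "C \<in> continuous_linear_maps H_ball"
proof -
  have "equicontinuous H_ball {(\<lambda>f. 1 *\<^sub>C (C ^^ n) f) | n. n \<in> {1}}"
  proof (rule equicontinuous_C_powers)
    fix K :: "'a set" assume K: "compact K" "K \<subseteq> ball 0 1"
    have "continuous_on K \<phi>"
      using holomorphic_map_on_continuous_on[OF holomorphic] K(2) by (rule continuous_on_subset)
    then have "compact (\<phi> ` K)" using K(1) by (rule compact_continuous_image)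
    moreover have "\<phi> ` K \<subseteq> ball 0 1" using K(2) self_map by blast
    ultimately show "\<exists>L. compact L \<and> L \<subseteq> ball 0 1 \<and> (\<forall>n\<in>{1}. (\<phi> ^^ n) ` K \<subseteq> L)"
      by (intro exI[where x = "\<phi> ` K"]) simp
  qed simp
  then show ?thesis
    by (simp add: equicontinuous_def scaleC_one)
qed

text \<open>Stable orbits speak of the iterates from the first on; adding \<open>K\<close> itself to \<open>L\<close> also takes
  care of the identity, the iterate of order zero.\<close>

lemma stable_orbits_imp_equicontinuous:
  assumes "stable_orbits (ball 0 1) \<phi>" and "\<And>n. n \<in> I \<Longrightarrow> cmod (c n) \<le> 1"
  shows "equicontinuous H_ball {(\<lambda>f. c n *\<^sub>C (C ^^ n) f) | n. n \<in> I}"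
proof (rule equicontinuous_C_powers[OF assms(2)])
  fix K :: "'a set" assume K: "compact K" "K \<subseteq> ball 0 1"
  then have "\<exists>L. compact L \<and> L \<subseteq> ball 0 1 \<and> (\<forall>n\<ge>1. (\<phi> ^^ n) ` K \<subseteq> L)"
    using assms(1) by (simp add: stable_orbits_def)
  then obtain L where L: "compact L" "L \<subseteq> ball 0 1" "\<forall>n\<ge>1. (\<phi> ^^ n) ` K \<subseteq> L"
    by blast
  have "(\<phi> ^^ n) ` K \<subseteq> K \<union> L" for n
  proof (cases "n = 0")
    case False
    then show ?thesis using L(3) by (simp add: le_supI2)
  qed simp
  then show "\<exists>L. compact L \<and> L \<subseteq> ball 0 1 \<and> (\<forall>n\<in>I. (\<phi> ^^ n) ` K \<subseteq> L)"
    using K L(1,2) by (intro exI[where x = "K \<union> L"]) (auto simp: compact_Un)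
qed

text \<open>The weights of the equicontinuous family serve as the topologizing sequence: some zero
  neighbourhood given by \<open>K\<close> and \<open>e\<close> is mapped by all \<open>a n C^n\<close> into the unit ball of \<open>q\<close>, so
  \<open>sup_on K / e\<close> dominates all of them.\<close>

lemma equicontinuous_imp_topologizable:
  assumes eq: "equicontinuous H_ball {(\<lambda>f. complex_of_real (a n) *\<^sub>C (C ^^ n) f) | n. n \<in> I}"
    and a: "\<And>n. n \<ge> 1 \<Longrightarrow> n \<in> I \<and> a n > 0"
  shows "topologizable H_ball C"
  unfolding topologizable_def
proof (intro conjI ballI C_continuous_linear)
  fix q :: "('a \<Rightarrow> complex) \<Rightarrow> real" assume "q \<in> continuous_seminorms H_ball"
  then have q_cont: "continuous_map H_ball euclideanreal q"
    and q_hom: "\<And>c f. f \<in> holo_ball \<Longrightarrow> q (c *\<^sub>C f) = cmod c * q f"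
    by (auto simp: continuous_seminorms_def topspace_H_ball)
  define V where "V = {f \<in> holo_ball. q f < 1}"
  have V: "openin H_ball V"
    using openin_continuous_map_preimage[OF q_cont, of "{..<1}"]
    by (simp add: V_def topspace_H_ball)
  have "q 0 = 0"
    using q_hom[OF holo_ball_zero, of 0] by (simp add: scaleC_fun_def scaleC_complex_def zero_fun_def)
  then have "0 \<in> V" by (simp add: V_def holo_ball_zero)
  then have "\<exists>U. openin H_ball U \<and> 0 \<in> U \<and>
      (\<forall>T\<in>{(\<lambda>f. complex_of_real (a n) *\<^sub>C (C ^^ n) f) | n. n \<in> I}. \<forall>f\<in>U. T f - T 0 \<in> V)"
    using eq[unfolded equicontinuous_def topspace_H_ball, THEN conjunct2] V holo_ball_zero by meson
  then obtain U where U: "openin H_ball U" "0 \<in> U"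
    and UV_family: "\<forall>T\<in>{(\<lambda>f. complex_of_real (a n) *\<^sub>C (C ^^ n) f) | n. n \<in> I}. \<forall>f\<in>U. T f - T 0 \<in> V"
    by (elim exE conjE)
  have UV: "complex_of_real (a n) *\<^sub>C (C ^^ n) f - complex_of_real (a n) *\<^sub>C (C ^^ n) 0 \<in> V"
    if n: "n \<in> I" and f: "f \<in> U" for n f
  proof -
    have "(\<lambda>f. complex_of_real (a n) *\<^sub>C (C ^^ n) f)
        \<in> {(\<lambda>f. complex_of_real (a n) *\<^sub>C (C ^^ n) f) | n. n \<in> I}"
      using n by (intro CollectI exI[where x = n] conjI refl)
    from bspec[OF bspec[OF UV_family this] f] show ?thesis .
  qed
  obtain K e where K: "compact K" "K \<subseteq> ball 0 1" "K \<noteq> {}" "e > 0"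
    and KU: "\<And>g. g \<in> holo_ball \<Longrightarrow> (\<And>x. x \<in> K \<Longrightarrow> cmod (g x - 0 x) < e) \<Longrightarrow> g \<in> U"
    using openin_H_ballE[OF U] by blast
  have "(C ^^ n) 0 = 0" for n
    using C_power_add[of n 0 0] by simp
  then have zero: "complex_of_real (a n) *\<^sub>C (C ^^ n) 0 = 0" for n
    by (simp add: scaleC_fun_def scaleC_complex_def zero_fun_def)
  have "q (complex_of_real (a n) *\<^sub>C (C ^^ n) f) \<le> 1 / e * sup_on K f"
    if n: "n \<ge> 1" and f: "f \<in> holo_ball" for n f
  proof (rule homogeneous_le_sup_on[OF K _ _ f])
    fix c and g :: "'a \<Rightarrow> complex" assume "g \<in> holo_ball"
    then have "q (c *\<^sub>C complex_of_real (a n) *\<^sub>C (C ^^ n) g) =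
        cmod c * q (complex_of_real (a n) *\<^sub>C (C ^^ n) g)"
      by (intro q_hom holo_ball_scaleC C_power_holo_ball)
    then show "q (complex_of_real (a n) *\<^sub>C (C ^^ n) (c *\<^sub>C g)) =
        cmod c * q (complex_of_real (a n) *\<^sub>C (C ^^ n) g)"
      by (simp add: C_power_scaleC scaleC_scaleC mult.commute)
  next
    fix g :: "'a \<Rightarrow> complex"
    assume "g \<in> holo_ball" "\<And>x. x \<in> K \<Longrightarrow> cmod (g x) < e"
    then have "g \<in> U" by (intro KU) auto
    then show "q (complex_of_real (a n) *\<^sub>C (C ^^ n) g) < 1"
      using UV[of n g] a[OF n] zero[of n] by (simp add: V_def)
  qed
  moreover have "(\<lambda>f. 1 / e * sup_on K f) \<in> continuous_seminorms H_ball"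
    using K(4) by (intro sup_on_continuous_seminorm K(1-3)) simp
  ultimately show "\<exists>a. \<exists>p\<in>continuous_seminorms H_ball. (\<forall>n\<ge>1. a n > 0) \<and>
      (\<forall>f\<in>topspace H_ball. \<forall>n\<ge>1. q (complex_of_real (a n) *\<^sub>C (C ^^ n) f) \<le> p f)"
    using a unfolding topspace_H_ball
    by (intro exI[where x = a] bexI[where x = "\<lambda>f. 1 / e * sup_on K f"]) blast+
qed

text \<open>Topologizability gives \<open>a n \<bar>f (\<phi>^n x)\<bar> \<le> sup_on L f / e\<close> for \<open>x \<in> K\<close>, with \<open>L\<close> and \<open>e\<close>
  independent of \<open>n\<close>. If \<open>y = \<phi>^n x\<close> were outside the closed convex hull of \<open>L\<close>, a functional
  separating it with gap \<open>d\<close> would give functions of modulus \<open>exp (m u)\<close>, whence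
  \<open>a n \<le> exp (- m d) / e\<close> for all \<open>m\<close>, against \<open>a n > 0\<close>. The size of the weights thus
  disappears, and the compact set that catches all orbits is the closed convex hull of \<open>L\<close>.\<close>

lemma topologizable_imp_stable_orbits:
  assumes "topologizable H_ball C"
  shows "stable_orbits (ball 0 1) \<phi>"
  unfolding stable_orbits_def
proof (intro allI impI)
  fix K :: "'a set" assume "compact K \<and> K \<subseteq> ball 0 1"
  then have K: "compact K" "K \<subseteq> ball 0 1" by auto
  show "\<exists>L. compact L \<and> L \<subseteq> ball 0 1 \<and> (\<forall>n\<ge>1. (\<phi> ^^ n) ` K \<subseteq> L)"
  proof (cases "K = {}")
    case True
    then show ?thesis by (intro exI[where x = "{}"]) simp
  next
    case False
    have "sup_on K \<in> continuous_seminorms H_ball"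
      using sup_on_continuous_seminorm[OF K False, of 1] by simp
    then obtain a :: "nat \<Rightarrow> real" and p where p: "p \<in> continuous_seminorms H_ball"
      and a: "\<And>n. n \<ge> 1 \<Longrightarrow> a n > 0"
      and le_p: "\<And>f n. f \<in> holo_ball \<Longrightarrow> n \<ge> 1 \<Longrightarrow>
        sup_on K (complex_of_real (a n) *\<^sub>C (C ^^ n) f) \<le> p f"
      using assms unfolding topologizable_def topspace_H_ball by metis
    have p_cont: "continuous_map H_ball euclideanreal p"
      and p_hom: "\<And>c f. f \<in> holo_ball \<Longrightarrow> p (c *\<^sub>C f) = cmod c * p f"
      using p by (auto simp: continuous_seminorms_def topspace_H_ball)
    have "openin H_ball {f \<in> holo_ball. p f < 1}"
      using openin_continuous_map_preimage[OF p_cont, of "{..<1}"] by (simp add: topspace_H_ball)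
    moreover have "p 0 = 0"
      using p_hom[OF holo_ball_zero, of 0]
      by (simp add: scaleC_fun_def scaleC_complex_def zero_fun_def)
    ultimately obtain L e where L: "compact L" "L \<subseteq> ball 0 1" "L \<noteq> {}" "e > 0"
      and small: "\<And>g. g \<in> holo_ball \<Longrightarrow> (\<And>x. x \<in> L \<Longrightarrow> cmod (g x - 0 x) < e) \<Longrightarrow> p g < 1"
      using openin_H_ballE[of "{f \<in> holo_ball. p f < 1}" 0] holo_ball_zero by auto
    have p_le: "p f \<le> 1 / e * sup_on L f" if "f \<in> holo_ball" for f
      by (rule homogeneous_le_sup_on[OF L p_hom _ that]) (auto intro: small)
    have "(\<phi> ^^ n) x \<in> closure (convex hull L)" if n: "n \<ge> 1" and x: "x \<in> K" for n x
    proof (rule ccontr)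
      define y where "y = (\<phi> ^^ n) x"
      have xy: "x \<in> ball 0 1" "y \<in> ball 0 1"
        using x K(2) iterate_in_ball[of x n] by (auto simp: y_def)
      assume "(\<phi> ^^ n) x \<notin> closure (convex hull L)"
      then have y: "y \<notin> closure (convex hull L)" by (simp add: y_def)
      have ne: "convex hull L \<noteq> {}" using L(3) by simp
      obtain u :: "'a \<Rightarrow> real" and d where u: "bounded_linear u" "d > 0" "\<And>c. c \<in> convex hull L \<Longrightarrow> u c \<le> u y - d"
        by (rule separating_functional[OF convex_convex_hull ne y]) (rule that)
      have "a n * e \<le> exp (- d) ^ m" for m
      proof -
        have "bounded_linear (\<lambda>z. real m * u z)"
          by (rule bounded_linear_const_mult[OF u(1)])
        then obtain f where f: "f \<in> holo_ball"
          "\<And>z. z \<in> ball 0 1 \<Longrightarrow> cmod (f z) = exp (real m * u z)"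
          by (rule exp_functional_holo_ball) blast
        have "a n * exp (real m * u y) = cmod ((complex_of_real (a n) *\<^sub>C (C ^^ n) f) x)"
          using C_power_apply[OF xy(1), of n f] f(2)[OF xy(2)] a[OF n]
          by (simp add: scaleC_fun_def scaleC_complex_def norm_mult y_def)
        also have "\<dots> \<le> sup_on K (complex_of_real (a n) *\<^sub>C (C ^^ n) f)"
          by (intro sup_on_upper K holo_ball_scaleC C_power_holo_ball f x)
        also have "\<dots> \<le> 1 / e * sup_on L f"
          using le_p[OF f(1) n] p_le[OF f(1)] by linarith
        also have "\<dots> \<le> 1 / e * exp (real m * (u y - d))"
        proof (intro mult_left_mono sup_on_least L)
          fix z assume z: "z \<in> L"
          then have "u z \<le> u y - d" by (intro u(3) hull_inc)
          moreover have "z \<in> ball 0 1" using z L(2) by blast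
          ultimately show "cmod (f z) \<le> exp (real m * (u y - d))"
            using f(2) by (simp add: mult_left_mono)
        qed (use L(4) in simp)
        also have "exp (real m * (u y - d)) = exp (real m * u y) * exp (- d) ^ m"
          by (simp add: right_diff_distrib flip: exp_of_nat_mult exp_add)
        finally show ?thesis using L(4) by (simp add: field_simps)
      qed
      moreover have "(\<lambda>m. exp (- d) ^ m) \<longlonglongrightarrow> 0"
        using u(2) by (intro LIMSEQ_power_zero) simp
      ultimately have "a n * e \<le> 0"
        by (intro LIMSEQ_le_const[where X = "\<lambda>m. exp (- d) ^ m"]) auto
      then show False
        using a[OF n] L(4) by (simp add: mult_le_0_iff)
    qed
    then show ?thesis
      using compact_closure_convex_hull[OF L(1)] closure_convex_hull_subset_ball[OF L(1,2)]
      by (intro exI[where x = "closure (convex hull L)"]) auto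
  qed
qed

end

theorem theorem4p3:
  fixes \<phi> :: "'a::complex_banach \<Rightarrow> 'a"
  assumes "holomorphic_map_on \<phi> (ball 0 1)"
    and "\<phi> ` ball 0 1 \<subseteq> ball 0 1"
  shows "(stable_orbits (ball 0 1) \<phi> \<longleftrightarrow> power_bounded H_ball (composition_operator \<phi>)) \<and>
    (power_bounded H_ball (composition_operator \<phi>) \<longleftrightarrow>
      equicontinuous H_ball
        {(\<lambda>f. (1 / of_nat n) *\<^sub>C (composition_operator \<phi> ^^ n) f) | n. n \<ge> 1}) \<and>
    (equicontinuous H_ball
        {(\<lambda>f. (1 / of_nat n) *\<^sub>C (composition_operator \<phi> ^^ n) f) | n. n \<ge> 1} \<longleftrightarrow>
      topologizable H_ball (composition_operator \<phi>))"
proof -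
  interpret holomorphic_self_map \<phi> by unfold_locales fact+
  have pb: "power_bounded H_ball C \<longleftrightarrow>
      equicontinuous H_ball {(\<lambda>f. complex_of_real 1 *\<^sub>C (C ^^ n) f) | n. n \<in> UNIV}"
    using C_continuous_linear by (simp add: power_bounded_def scaleC_one)
  have cesaro: "{(\<lambda>f. (1 / of_nat n) *\<^sub>C (C ^^ n) f) | n. n \<ge> 1} =
      {(\<lambda>f. complex_of_real (1 / real n) *\<^sub>C (C ^^ n) f) | n. n \<in> {1..}}"
    by simp
  have "power_bounded H_ball C" if "stable_orbits (ball 0 1) \<phi>"
    unfolding pb by (rule stable_orbits_imp_equicontinuous[OF that]) simp
  moreover have "equicontinuous H_ball {(\<lambda>f. (1 / of_nat n) *\<^sub>C (C ^^ n) f) | n. n \<ge> 1}"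
    if "stable_orbits (ball 0 1) \<phi>"
    unfolding cesaro
    by (rule stable_orbits_imp_equicontinuous[OF that]) (simp add: norm_divide)
  moreover have "topologizable H_ball C" if "power_bounded H_ball C"
    using that unfolding pb by (rule equicontinuous_imp_topologizable) simp
  moreover have "topologizable H_ball C"
    if "equicontinuous H_ball {(\<lambda>f. (1 / of_nat n) *\<^sub>C (C ^^ n) f) | n. n \<ge> 1}"
    using that unfolding cesaro by (rule equicontinuous_imp_topologizable) simp
  moreover note topologizable_imp_stable_orbits
  ultimately show ?thesis by blast
qed

end
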